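(* Let $G^\sigma$ be a signed graph whose underlying graph $G$ is connected and bipartite, and whose adjacency matrix has all but at most two eigenvalues (counted with multiplicity) equal to $\pm1$. Then $G^\sigma$ is switching isomorphic with an unsigned (all edges positive) connected bipartite graph whose adjacency matrix also has all but at most two eigenvalues equal to $\pm 1$.
   Context: A signed graph $G^\sigma$ is a finite simple graph $G$ with a signature $\sigma:E(G)\to\{-1,+1\}$; its adjacency matrix has entry $\sigma(\{u,v\})$ for edges and $0$ otherwise. Switching with respect to a vertex subset $X$ changes the sign of every edge between $X$ and $V\setminus X$; two signed graphs are switching isomorphic if one can be switched into an isomorphic copy of the other. *)

theory Defs
  imports
    "Graph_Theory.Pair_Digraph"
    "Graph_Theory.Digraph_Component"
    "Jordan_Normal_Form.Char_Poly"
    "HOL-Computational_Algebra.Fundamental_Theorem_Algebra"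
begin

(* Finite simple graphs are the instances of pair_graph: an edge {u, v} is represented by
   the two arcs (u, v) and (v, u). A signature is a function on two-element vertex sets;
   its values on sets that are not edges are irrelevant everywhere below. *)

definition signed_graph :: "'a pair_pre_digraph \<Rightarrow> ('a set \<Rightarrow> int) \<Rightarrow> bool" where
  "signed_graph G \<sigma> \<longleftrightarrow> pair_graph G \<and> (\<forall>(u, v) \<in> parcs G. \<sigma> {u, v} \<in> {-1, 1})"

definition connected_graph :: "'a pair_pre_digraph \<Rightarrow> bool" where
  "connected_graph G \<longleftrightarrow> Digraph_Component.connected (with_proj G)"

definition bipartite_graph :: "'a pair_pre_digraph \<Rightarrow> bool" where
  "bipartite_graph G \<longleftrightarrow>
     (\<exists>X Y. pverts G = X \<union> Y \<and> X \<inter> Y = {} \<and> parcs G \<subseteq> X \<times> Y \<union> Y \<times> X)"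

definition all_positive :: "'a set \<Rightarrow> int" where
  "all_positive = (\<lambda>_. 1)"

definition switch :: "'a set \<Rightarrow> ('a set \<Rightarrow> int) \<Rightarrow> 'a set \<Rightarrow> int" where
  "switch X \<sigma> e = (if e \<inter> X \<noteq> {} \<and> \<not> e \<subseteq> X then - \<sigma> e else \<sigma> e)"

definition signed_graph_iso ::
    "'a pair_pre_digraph \<Rightarrow> ('a set \<Rightarrow> int) \<Rightarrow> 'b pair_pre_digraph \<Rightarrow> ('b set \<Rightarrow> int) \<Rightarrow> bool" where
  "signed_graph_iso G \<sigma> H \<tau> \<longleftrightarrow>
     (\<exists>f. bij_betw f (pverts G) (pverts H) \<and>
          (\<forall>u \<in> pverts G. \<forall>v \<in> pverts G. (u, v) \<in> parcs G \<longleftrightarrow> (f u, f v) \<in> parcs H) \<and>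
          (\<forall>(u, v) \<in> parcs G. \<tau> {f u, f v} = \<sigma> {u, v}))"

definition switching_isomorphic ::
    "'a pair_pre_digraph \<Rightarrow> ('a set \<Rightarrow> int) \<Rightarrow> 'b pair_pre_digraph \<Rightarrow> ('b set \<Rightarrow> int) \<Rightarrow> bool" where
  "switching_isomorphic G \<sigma> H \<tau> \<longleftrightarrow>
     (\<exists>X. X \<subseteq> pverts G \<and> signed_graph_iso G (switch X \<sigma>) H \<tau>)"

(* Matrices here are indexed by natural numbers, so the vertices are listed in some fixed
   order; another order only conjugates the adjacency matrix by a permutation matrix. *)
definition vertex_order :: "'a pair_pre_digraph \<Rightarrow> 'a list" where
  "vertex_order G = (SOME vs. distinct vs \<and> set vs = pverts G)"

definition adjacency_matrix :: "'a pair_pre_digraph \<Rightarrow> ('a set \<Rightarrow> int) \<Rightarrow> real mat" where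
  "adjacency_matrix G \<sigma> =
     (let vs = vertex_order G in
      mat (length vs) (length vs)
        (\<lambda>(i, j). if (vs ! i, vs ! j) \<in> parcs G then real_of_int (\<sigma> {vs ! i, vs ! j}) else 0))"

(* Complex roots of the characteristic polynomial, so that the multiset has as many elements
   as the matrix has rows. *)
definition eigenvalues_mset :: "real mat \<Rightarrow> complex multiset" where
  "eigenvalues_mset A = proots (char_poly (map_mat complex_of_real A))"

lemma vertex_order:
  assumes "pair_graph G"
  shows "distinct (vertex_order G)" "set (vertex_order G) = pverts G"
proof -
  interpret pair_graph G by fact
  have "\<exists>vs. distinct vs \<and> set vs = pverts G"
    using finite_distinct_list[OF pair_finite_verts] by blast
  from someI_ex[OF this] show "distinct (vertex_order G)" "set (vertex_order G) = pverts G"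
    by (simp_all add: vertex_order_def)
qed

lemma size_eigenvalues_mset:
  assumes "A \<in> carrier_mat n n"
  shows "size (eigenvalues_mset A) = n"
  using assms degree_monic_char_poly[of "map_mat complex_of_real A" n]
  by (simp add: eigenvalues_mset_def size_proots_complex)

end

theory Submission
  imports
    Defs
    "Jordan_Normal_Form.Jordan_Normal_Form_Existence"
    "Jordan_Normal_Form.Jordan_Normal_Form_Uniqueness"
begin

text \<open>
  Let A be the signed adjacency matrix. Being Hermitian, it is diagonalizable, so A A - I has at most
  as many nonzero eigenvalues as A has eigenvalues different from 1 and -1, and its rank is at most
  two. By bipartiteness A A - I is block diagonal with respect to the two parts; hence one block
  vanishes or the other one has rank at most one, and in either case all 2x2 minors of some block
  vanish. The entries of that block are the inner products of distinct rows and the reduced degrees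
  deg x - 1 on the diagonal, so the inner product of two rows x and y is, up to sign, the geometric
  mean of deg x - 1 and deg y - 1. If deg x is the smaller degree, this is at least deg x - 1, while
  there are at most deg x common neighbours; a single disagreement of signs would cost 2. So any two
  rows agree up to a global sign on their common support. The rank one structure makes these global
  signs consistent, so the graph is balanced and can be switched to all positive signs, which
  conjugates A by a diagonal sign matrix.
\<close>

section \<open>Hermitian matrices\<close>

lemma mat_adjoint_dim [simp]:
  "dim_row (mat_adjoint A) = dim_col A" "dim_col (mat_adjoint A) = dim_row A"
  by (simp_all add: mat_adjoint_def)

lemma mat_adjoint_index [simp]:
  "i < dim_col A \<Longrightarrow> j < dim_row A \<Longrightarrow> mat_adjoint A $$ (i, j) = conjugate (A $$ (j, i))"
  by (simp add: mat_adjoint_def mat_of_rows_index)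

lemma cscalar_prod_mult_mat_vec:
  fixes A :: "'a :: conjugatable_field mat"
  assumes A: "A \<in> carrier_mat nr nc" and u: "u \<in> carrier_vec nc" and v: "v \<in> carrier_vec nr"
  shows "(A *\<^sub>v u) \<bullet>c v = u \<bullet>c (mat_adjoint A *\<^sub>v v)"
proof -
  have "(A *\<^sub>v u) \<bullet>c v = (\<Sum>i<nr. \<Sum>j<nc. A $$ (i, j) * u $ j * conjugate (v $ i))"
    using assms by (simp add: scalar_prod_def sum_distrib_right lessThan_atLeast0)
  also have "\<dots> = (\<Sum>j<nc. \<Sum>i<nr. A $$ (i, j) * u $ j * conjugate (v $ i))"
    by (rule sum.swap)
  also have "\<dots> = u \<bullet>c (mat_adjoint A *\<^sub>v v)"
    using assms
    by (simp add: scalar_prod_def sum_distrib_left sum_conjugate conjugate_dist_mul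
        lessThan_atLeast0 ac_simps)
  finally show ?thesis .
qed

lemma hermitian_eigenvalue_self_conjugate:
  fixes A :: "'a :: conjugatable_ordered_field mat"
  assumes A: "A \<in> carrier_mat n n" and herm: "mat_adjoint A = A" and e: "eigenvalue A e"
  shows "conjugate e = e"
proof -
  obtain v where v: "v \<in> carrier_vec n" "v \<noteq> 0\<^sub>v n" and Av: "A *\<^sub>v v = e \<cdot>\<^sub>v v"
    using e A by (auto simp: eigenvalue_def eigenvector_def)
  have "e * (v \<bullet>c v) = (A *\<^sub>v v) \<bullet>c v"
    using v by (simp add: Av)
  also have "\<dots> = v \<bullet>c (A *\<^sub>v v)"
    using cscalar_prod_mult_mat_vec[OF A v(1) v(1)] herm by simp
  also have "\<dots> = conjugate e * (v \<bullet>c v)"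
    using v by (simp add: Av conjugate_smult_vec)
  finally show ?thesis
    using v by simp
qed

lemma hermitian_pow_mult_vec_eq_0:
  fixes A :: "'a :: conjugatable_ordered_field mat"
  assumes A: "A \<in> carrier_mat n n" and herm: "mat_adjoint A = A"
    and v: "v \<in> carrier_vec n" and zero: "A ^\<^sub>m Suc k *\<^sub>v v = 0\<^sub>v n"
  shows "A *\<^sub>v v = 0\<^sub>v n"
  using v zero
proof (induction k arbitrary: v)
  case 0
  then show ?case using A by simp
next
  case (Suc k)
  have Av: "A *\<^sub>v v \<in> carrier_vec n" using A Suc.prems by simp
  have "A ^\<^sub>m Suc k *\<^sub>v (A *\<^sub>v v) = 0\<^sub>v n"
    using Suc.prems assoc_mult_mat_vec[OF pow_carrier_mat[OF A, of "Suc k"] A] by simp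
  then have "A *\<^sub>v (A *\<^sub>v v) = 0\<^sub>v n"
    by (rule Suc.IH[OF Av])
  then have "(A *\<^sub>v v) \<bullet>c (A *\<^sub>v v) = 0"
    using cscalar_prod_mult_mat_vec[OF A Suc.prems(1) Av] herm Suc.prems(1) by simp
  then show ?case using Av by simp
qed

lemma hermitian_mat_kernel_pow:
  fixes A :: "'a :: conjugatable_ordered_field mat"
  assumes A: "A \<in> carrier_mat n n" and herm: "mat_adjoint A = A"
  shows "mat_kernel (A ^\<^sub>m Suc k) = mat_kernel A"
proof -
  have "A ^\<^sub>m Suc k *\<^sub>v v = 0\<^sub>v n" if "v \<in> carrier_vec n" "A *\<^sub>v v = 0\<^sub>v n" for v
    using that A assoc_mult_mat_vec[OF pow_carrier_mat[OF A, of k] A that(1)]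
    by (intro eq_vecI) auto
  then show ?thesis
    unfolding mat_kernel[OF pow_carrier_mat[OF A]] mat_kernel[OF A]
    using hermitian_pow_mult_vec_eq_0[OF A herm, of _ k] by blast
qed

lemma jordan_nf_eigenvalue:
  assumes A: "A \<in> carrier_mat n n" and jnf: "jordan_nf A n_as" and block: "(m, e) \<in> set n_as"
  shows "eigenvalue A (e :: 'a :: field)"
proof -
  have "m \<noteq> 0" using jnf block by (force simp: jordan_nf_def)
  then have "poly (\<Prod>(k, a)\<leftarrow>n_as. [:- a, 1:] ^ k) e = 0"
    using block by (force simp: poly_prod_list prod_list_zero_iff o_def)
  then show ?thesis
    by (simp add: eigenvalue_root_char_poly[OF A] jordan_nf_char_poly[OF jnf])
qed

lemma hermitian_jordan_block_size:
  fixes A :: "'a :: conjugatable_ordered_field mat"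
  assumes A: "A \<in> carrier_mat n n" and herm: "mat_adjoint A = A"
    and jnf: "jordan_nf A n_as" and block: "(m, e) \<in> set n_as"
  shows "m = 1"
proof -
  let ?C = "char_matrix A e"
  have C: "?C \<in> carrier_mat n n" using A by simp
  have "conjugate (a - e) = conjugate a - e" for a
    using hermitian_eigenvalue_self_conjugate[OF A herm jordan_nf_eigenvalue[OF A jnf block]]
      conjugate_dist_add[of a "- e"] by (simp add: conjugate_neg)
  moreover have "conjugate (A $$ (i, j)) = A $$ (j, i)" if "i < n" "j < n" for i j
    using that A mat_adjoint_index[of j A i] by (simp add: herm)
  ultimately have C_herm: "mat_adjoint ?C = ?C"
    using A by (intro eq_matI) (auto simp: char_matrix_def)
  then have "mat_kernel (?C ^\<^sub>m Suc k) = mat_kernel ?C" for k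
    by (rule hermitian_mat_kernel_pow[OF C])
  then have dim_const: "dim_gen_eigenspace A e (Suc k) = dim_gen_eigenspace A e 1" for k
    using C by (simp add: dim_gen_eigenspace_def kernel_dim_def)
  have "compute_nr_of_jordan_blocks A e (Suc (Suc k)) = 0" for k
    using dim_const[of k] dim_const[of "Suc k"] dim_const[of "Suc (Suc k)"]
    by (simp add: compute_nr_of_jordan_blocks_def)
  then have "m \<noteq> Suc (Suc k)" for k
    using compute_nr_of_jordan_blocks[OF jnf, of "Suc (Suc k)" e] block
    by (auto simp: filter_empty_conv)
  moreover have "m \<noteq> 0" using jnf block by (force simp: jordan_nf_def)
  ultimately show ?thesis
    by (metis One_nat_def nat.exhaust)
qed

lemma jordan_matrix_blocks_size_1:
  assumes "\<And>m e. (m, e) \<in> set n_as \<Longrightarrow> m = 1"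
  shows "jordan_matrix n_as = mat_diag (length n_as) (\<lambda>i. snd (n_as ! i))"
  using assms
proof (induction n_as)
  case Nil
  then show ?case by (auto simp: jordan_matrix_def mat_diag_def)
next
  case (Cons ne n_as)
  obtain e where ne: "ne = (1, e)" using Cons.prems by (cases ne) auto
  have IH: "jordan_matrix n_as = mat_diag (length n_as) (\<lambda>i. snd (n_as ! i))"
    by (rule Cons.IH) (erule Cons.prems[OF list.set_intros(2)])
  have "sum_list (map fst n_as) = length n_as"
    using arg_cong[OF IH, of dim_row] by (simp add: mat_diag_def)
  then show ?case
    unfolding ne jordan_matrix_Cons IH by (intro eq_matI) (auto simp: mat_diag_def)
qed

theorem hermitian_diagonalizable:
  fixes A :: "complex mat"
  assumes A: "A \<in> carrier_mat n n" and herm: "mat_adjoint A = A"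
  obtains d P Q where "similar_mat_wit A (mat_diag n d) P Q"
proof -
  obtain as where "char_poly A = (\<Prod>a\<leftarrow>as. [:- a, 1:])"
    using char_poly_factorized[OF A] by blast
  then obtain n_as where jnf: "jordan_nf A n_as"
    using jordan_nf_exists[OF A] by blast
  then have "jordan_matrix n_as = mat_diag (length n_as) (\<lambda>i. snd (n_as ! i))"
    by (intro jordan_matrix_blocks_size_1 hermitian_jordan_block_size[OF A herm])
  then obtain P Q where "similar_mat_wit A (mat_diag (length n_as) (\<lambda>i. snd (n_as ! i))) P Q"
    using jnf by (auto simp: jordan_nf_def similar_mat_def)
  moreover from this have "length n_as = n"
    using similar_mat_witD2(5)[OF A] by (metis carrier_matD(1) mat_diag_dim)
  ultimately show thesis using that by simp
qed

lemma proots_char_poly_diagonalizable: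
  fixes A :: "'a :: field mat"
  assumes "similar_mat_wit A (mat_diag n d) P Q"
  shows "proots (char_poly A) = mset (map d [0..<n])"
proof -
  have "similar_mat A (mat_diag n d)" using assms by (auto simp: similar_mat_def)
  then have "char_poly A = char_poly (mat_diag n d)" by (rule char_poly_similar)
  also have "\<dots> = (\<Prod>a\<leftarrow>diag_mat (mat_diag n d). [:- a, 1:])"
    by (rule char_poly_upper_triangular[of _ n]) (auto simp: mat_diag_def)
  also have "diag_mat (mat_diag n d) = map d [0..<n]"
    by (simp add: diag_mat_def mat_diag_def)
  finally have "char_poly A = (\<Prod>p\<leftarrow>map (\<lambda>i. [:- d i, 1:]) [0..<n]. p)"
    by (simp add: o_def)
  moreover have "(\<Sum>i\<leftarrow>ks. {#d i#}) = mset (map d ks)" for ks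
    by (induction ks) simp_all
  ultimately show ?thesis
    using proots_prod_list[of "map (\<lambda>i. [:- d i, 1:]) [0..<n]"] by (simp add: image_iff o_def)
qed

section \<open>Matrices of bounded rank\<close>

definition rank_at_most ::
    "nat \<Rightarrow> 'i set \<Rightarrow> 'j set \<Rightarrow> ('i \<Rightarrow> 'j \<Rightarrow> 'a :: comm_semiring_1) \<Rightarrow> bool" where
  "rank_at_most r I J M \<longleftrightarrow> (\<exists>(K :: nat set) a b. finite K \<and> card K \<le> r \<and>
     (\<forall>i\<in>I. \<forall>j\<in>J. M i j = (\<Sum>k\<in>K. a i k * b k j)))"

lemma rank_at_most_mono:
  assumes "rank_at_most r I J M" "r \<le> s"
  shows "rank_at_most s I J M"
  using assms unfolding rank_at_most_def by (meson le_trans)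

lemma rank_at_most_reindex:
  assumes rank: "rank_at_most r I J M"
    and "\<And>u. u \<in> U \<Longrightarrow> f u \<in> I" "\<And>v. v \<in> V \<Longrightarrow> g v \<in> J"
  shows "rank_at_most r U V (\<lambda>u v. M (f u) (g v))"
proof -
  obtain K :: "nat set" and a b where K: "finite K" "card K \<le> r"
    and M: "\<And>i j. i \<in> I \<Longrightarrow> j \<in> J \<Longrightarrow> M i j = (\<Sum>k\<in>K. a i k * b k j)"
    using rank unfolding rank_at_most_def by blast
  show ?thesis
    unfolding rank_at_most_def using K
    by (intro exI[of _ K] exI[of _ "\<lambda>u. a (f u)"] exI[of _ "\<lambda>k v. b k (g v)"])
      (simp add: M assms(2,3))
qed

lemma det_eq_0_if_rank_at_most:
  fixes M :: "'i \<Rightarrow> 'j \<Rightarrow> 'a :: comm_ring_1"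
  assumes rank: "rank_at_most r I J M" and "r < n"
    and f: "\<And>i. i < n \<Longrightarrow> f i \<in> I" and g: "\<And>j. j < n \<Longrightarrow> g j \<in> J"
  shows "det (mat n n (\<lambda>(i, j). M (f i) (g j))) = 0"
proof -
  obtain K :: "nat set" and a b where K: "finite K" "card K \<le> r"
    and M: "\<And>i j. i \<in> I \<Longrightarrow> j \<in> J \<Longrightarrow> M i j = (\<Sum>k\<in>K. a i k * b k j)"
    using rank unfolding rank_at_most_def by blast
  obtain h where h: "bij_betw h {..<card K} K"
    using ex_bij_betw_nat_finite[OF K(1)] by (auto simp: lessThan_atLeast0)
  have "card K < n" using K(2) \<open>r < n\<close> by simp
  define A where "A = mat n n (\<lambda>(i, k). a (f i) (h k))"
  define c where "c k = vec n (\<lambda>j. b (h k) (g j))" for k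
  define B where "B = mat\<^sub>r n n (\<lambda>k. if k < card K then c k else 0\<^sub>v n)"
  have carrier: "A \<in> carrier_mat n n" "B \<in> carrier_mat n n" by (simp_all add: A_def B_def)
  have "mat n n (\<lambda>(i, j). M (f i) (g j)) = A * B"
  proof (rule eq_matI)
    fix i j assume "i < dim_row (A * B)" "j < dim_col (A * B)"
    then have ij: "i < n" "j < n" using carrier by simp_all
    have "(A * B) $$ (i, j) = (\<Sum>k<n. a (f i) (h k) * (if k < card K then b (h k) (g j) else 0))"
      using ij by (auto simp: A_def B_def c_def scalar_prod_def lessThan_atLeast0 intro!: sum.cong)
    also have "\<dots> = (\<Sum>k<card K. a (f i) (h k) * b (h k) (g j))"
      using \<open>card K < n\<close> by (intro sum.mono_neutral_cong_right) auto
    also have "\<dots> = (\<Sum>k\<in>K. a (f i) k * b k (g j))"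
      by (rule sum.reindex_bij_betw[OF h])
    finally show "mat n n (\<lambda>(i, j). M (f i) (g j)) $$ (i, j) = (A * B) $$ (i, j)"
      using ij by (simp add: M f g)
  qed (simp_all add: A_def B_def)
  moreover have "det B = 0"
  proof -
    have "B = mat\<^sub>r n n (\<lambda>k. if k = card K then 0\<^sub>v n else if k < card K then c k else 0\<^sub>v n)"
      by (auto simp: B_def intro!: eq_matI)
    also have "det \<dots> = 0"
      using \<open>card K < n\<close> by (intro det_row_0) (auto simp: c_def)
    finally show ?thesis .
  qed
  ultimately show ?thesis using det_mult[OF carrier] by simp
qed

lemma det_eq_0_if_bordered_rank_at_most:
  fixes M :: "'i \<Rightarrow> 'j \<Rightarrow> 'a :: idom"
  assumes rank: "rank_at_most n I J M"
    and f: "\<And>i. i < n \<Longrightarrow> f i \<in> I" and g: "\<And>j. j < n \<Longrightarrow> g j \<in> J"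
    and yz: "y \<in> I" "z \<in> J" "M y z \<noteq> 0" and column: "\<And>i. i < n \<Longrightarrow> M (f i) z = 0"
  shows "det (mat n n (\<lambda>(i, j). M (f i) (g j))) = 0"
proof -
  let ?A = "mat n n (\<lambda>(i, j). M (f i) (g j))"
  let ?f = "\<lambda>i. if i < n then f i else y" and ?g = "\<lambda>j. if j < n then g j else z"
  have "mat (Suc n) (Suc n) (\<lambda>(i, j). M (?f i) (?g j)) =
      four_block_mat ?A (0\<^sub>m n 1) (mat 1 n (\<lambda>(i, j). M y (g j))) (mat 1 1 (\<lambda>_. M y z))"
    by (rule eq_matI) (auto simp: column)
  then have "det (mat (Suc n) (Suc n) (\<lambda>(i, j). M (?f i) (?g j))) = det ?A * M y z"
    by (simp add: det_four_block_mat_upper_right_zero_col[of _ n] det_single)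
  moreover have "det (mat (Suc n) (Suc n) (\<lambda>(i, j). M (?f i) (?g j))) = 0"
    by (rule det_eq_0_if_rank_at_most[OF rank]) (simp_all add: f g yz)
  ultimately show ?thesis using yz by simp
qed

lemma det_mat_2:
  fixes M :: "nat \<Rightarrow> nat \<Rightarrow> 'a :: comm_ring_1"
  shows "det (mat 2 2 (\<lambda>(i, j). M i j)) = M 0 0 * M 1 1 - M 0 1 * M 1 0"
proof -
  have "det (mat 2 2 (\<lambda>(i, j). M i j)) =
      (\<Sum>j<2. M 0 j * cofactor (mat 2 2 (\<lambda>(i, j). M i j)) 0 j)"
    by (subst laplace_expansion_row[of _ 2 0]) simp_all
  then show ?thesis
    by (simp add: numeral_2_eq_2 cofactor_def mat_delete_def det_single)
qed

lemma rank_at_most_diagonalizable: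
  assumes wit: "similar_mat_wit A (mat_diag n d) P Q"
  shows "rank_at_most (card {k. k < n \<and> d k \<noteq> 0}) {..<n} {..<n} (\<lambda>i j. A $$ (i, j))"
proof -
  have dim: "n = dim_row A"
    using similar_mat_witD(5)[OF refl wit] by (metis carrier_matD(1) mat_diag_dim)
  have A: "A = P * mat_diag n d * Q" and P: "P \<in> carrier_mat n n" and Q: "Q \<in> carrier_mat n n"
    using similar_mat_witD(3,6,7)[OF dim wit] by simp_all
  have "A $$ (i, j) = (\<Sum>k\<in>{k. k < n \<and> d k \<noteq> 0}. (P $$ (i, k) * d k) * Q $$ (k, j))"
    if "i < n" "j < n" for i j
  proof -
    have "A $$ (i, j) = (\<Sum>k<n. (P $$ (i, k) * d k) * Q $$ (k, j))"
      using that P Q unfolding A mat_diag_mult_right[OF P]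
      by (simp add: scalar_prod_def lessThan_atLeast0)
    also have "\<dots> = (\<Sum>k\<in>{k. k < n \<and> d k \<noteq> 0}. (P $$ (i, k) * d k) * Q $$ (k, j))"
      by (rule sum.mono_neutral_right) auto
    finally show ?thesis .
  qed
  then show ?thesis
    unfolding rank_at_most_def
    by (intro exI[of _ "{k. k < n \<and> d k \<noteq> 0}"] exI[of _ "\<lambda>i k. P $$ (i, k) * d k"]
        exI[of _ "\<lambda>k j. Q $$ (k, j)"]) simp
qed

lemma mat_diag_pow: "mat_diag n d ^\<^sub>m k = mat_diag n (\<lambda>i. d i ^ k)"
proof (induction k)
  case 0
  show ?case by (simp add: mat_diag_def one_mat_def)
next
  case (Suc k)
  then show ?case by (simp add: power_Suc2 del: power_Suc)
qed

lemma char_matrix_mat_diag: "char_matrix (mat_diag n d) e = mat_diag n (\<lambda>i. d i - e)"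
  by (intro eq_matI) (auto simp: char_matrix_def mat_diag_def)

theorem hermitian_rank_char_matrix_pow:
  fixes A :: "complex mat"
  assumes A: "A \<in> carrier_mat n n" and herm: "mat_adjoint A = A"
  shows "rank_at_most (size {#x \<in># proots (char_poly A). x ^ k \<noteq> e#}) {..<n} {..<n}
    (\<lambda>i j. char_matrix (A ^\<^sub>m k) e $$ (i, j))"
proof -
  obtain d P Q where wit: "similar_mat_wit A (mat_diag n d) P Q"
    using hermitian_diagonalizable[OF A herm] .
  have "similar_mat_wit (char_matrix (A ^\<^sub>m k) e) (mat_diag n (\<lambda>i. d i ^ k - e)) P Q"
    using similar_mat_wit_char_matrix[OF similar_mat_wit_pow[OF wit], of k e]
    by (simp add: mat_diag_pow char_matrix_mat_diag)
  moreover have "size {#x \<in># proots (char_poly A). x ^ k \<noteq> e#} =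
      card {i. i < n \<and> d i ^ k - e \<noteq> 0}"
  proof -
    have "{#x \<in># proots (char_poly A). x ^ k \<noteq> e#} =
        mset (filter (\<lambda>x. x ^ k \<noteq> e) (map d [0..<n]))"
      by (simp only: proots_char_poly_diagonalizable[OF wit] mset_filter)
    then have "size {#x \<in># proots (char_poly A). x ^ k \<noteq> e#} =
        length (filter (\<lambda>i. d i ^ k \<noteq> e) [0..<n])"
      by (simp only: size_mset filter_map length_map o_def)
    also have "\<dots> = card ({i. d i ^ k \<noteq> e} \<inter> set [0..<n])"
      by (simp add: distinct_length_filter)
    also have "{i. d i ^ k \<noteq> e} \<inter> set [0..<n] = {i. i < n \<and> d i ^ k - e \<noteq> 0}"
      by auto
    finally show ?thesis .
  qed
  ultimately show ?thesis
    by (auto dest!: rank_at_most_diagonalizable)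
qed

section \<open>Sign patterns of rank one\<close>

definition minors2_vanish_on :: "'i set \<Rightarrow> ('i \<Rightarrow> 'i \<Rightarrow> 'a :: times) \<Rightarrow> bool" where
  "minors2_vanish_on X M \<longleftrightarrow>
     (\<forall>i\<in>X. \<forall>j\<in>X. \<forall>k\<in>X. \<forall>l\<in>X. M i j * M k l = M i l * M k j)"

lemma minors2_vanish_onD:
  "minors2_vanish_on X M \<Longrightarrow> i \<in> X \<Longrightarrow> j \<in> X \<Longrightarrow> k \<in> X \<Longrightarrow> l \<in> X \<Longrightarrow>
    M i j * M k l = M i l * M k j"
  by (auto simp: minors2_vanish_on_def)

lemma minors2_vanish_on_subset: "minors2_vanish_on X M \<Longrightarrow> U \<subseteq> X \<Longrightarrow> minors2_vanish_on U M"
  unfolding minors2_vanish_on_def by blast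

lemma diag_block_rank_2_minors2_vanish:
  fixes M :: "'i \<Rightarrow> 'i \<Rightarrow> 'a :: idom"
  assumes rank: "rank_at_most 2 (X \<union> Y) (X \<union> Y) M"
    and off_block: "\<And>x y. x \<in> X \<Longrightarrow> y \<in> Y \<Longrightarrow> M x y = 0"
  shows "minors2_vanish_on X M \<or> (\<forall>y\<in>Y. \<forall>z\<in>Y. M y z = 0)"
proof (rule disjCI)
  assume "\<not> (\<forall>y\<in>Y. \<forall>z\<in>Y. M y z = 0)"
  then obtain y z where yz: "y \<in> Y" "z \<in> Y" "M y z \<noteq> 0" by blast
  show "minors2_vanish_on X M"
    unfolding minors2_vanish_on_def
  proof (intro ballI)
    fix i j k l assume X: "i \<in> X" "j \<in> X" "k \<in> X" "l \<in> X"
    let ?f = "\<lambda>m :: nat. if m = 0 then i else k" and ?g = "\<lambda>m :: nat. if m = 0 then j else l"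
    have "det (mat 2 2 (\<lambda>(a, b). M (?f a) (?g b))) = 0"
      using X yz off_block
      by (intro det_eq_0_if_bordered_rank_at_most[OF rank, where y = y and z = z]) auto
    then show "M i j * M k l = M i l * M k j"
      by (simp add: det_mat_2)
  qed
qed

lemma rank_one_diag_le_abs_entry:
  fixes M :: "'i \<Rightarrow> 'i \<Rightarrow> 'a :: linordered_idom"
  assumes minors: "minors2_vanish_on X M" and sym: "\<And>x y. M x y = M y x"
    and xy: "x \<in> X" "y \<in> X" and diag: "0 \<le> M x x" "M x x \<le> M y y"
  shows "M x x \<le> \<bar>M x y\<bar>"
proof (rule power2_le_imp_le)
  have "(M x x)\<^sup>2 \<le> M x x * M y y"
    using diag by (simp add: power2_eq_square mult_left_mono)
  also have "\<dots> = M x y * M y x"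
    by (rule minors2_vanish_onD[OF minors]) (use xy in simp_all)
  also have "\<dots> = \<bar>M x y\<bar>\<^sup>2"
    using sym[of y x] by (simp add: power2_eq_square)
  finally show "(M x x)\<^sup>2 \<le> \<bar>M x y\<bar>\<^sup>2" .
qed simp

lemma rank_one_psd_signs:
  fixes M :: "'i \<Rightarrow> 'i \<Rightarrow> 'a :: linordered_idom"
  assumes minors: "minors2_vanish_on X M" and sym: "\<And>x y. M x y = M y x"
    and diag: "\<And>x. x \<in> X \<Longrightarrow> 0 \<le> M x x"
  obtains p :: "'i \<Rightarrow> 'a" where "\<And>x. p x \<in> {-1, 1}"
    "\<And>x y. x \<in> X \<Longrightarrow> y \<in> X \<Longrightarrow> p x * p y * M x y = \<bar>M x y\<bar>"
proof (cases "\<exists>i\<in>X. M i i \<noteq> 0")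
  case True
  then obtain i where i: "i \<in> X" "0 < M i i"
    using diag by (metis less_le)
  define p :: "'i \<Rightarrow> 'a" where "p x = (if M i x < 0 then -1 else 1)" for x
  have p: "p x \<in> {-1, 1}" for x by (simp add: p_def)
  have "p x * p y * M x y = \<bar>M x y\<bar>" if "x \<in> X" "y \<in> X" for x y
  proof -
    have "M i i * (p x * p y * M x y) = p x * p y * (M i y * M x i)"
      using minors2_vanish_onD[OF minors i(1) i(1) that] by simp
    also have "\<dots> = (p x * M i x) * (p y * M i y)"
      using sym[of x i] by simp
    also have "\<dots> \<ge> 0"
      by (rule mult_nonneg_nonneg) (auto simp: p_def)
    finally have "0 \<le> p x * p y * M x y"
      using i(2) by (simp add: zero_le_mult_iff)
    then show ?thesis
      using p[of x] p[of y] by auto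
  qed
  with p show ?thesis by (rule that)
next
  case False
  have "M x y = 0" if "x \<in> X" "y \<in> X" for x y
    using minors2_vanish_onD[OF minors, of x x y y] that False sym[of y x] by auto
  then show ?thesis
    using that[of "\<lambda>_. 1"] by simp
qed

lemma aligned_if_abs_sum_le_inner_product:
  fixes a b :: "'b \<Rightarrow> 'a :: linordered_idom"
  assumes W: "finite W" "w \<in> W"
    and a: "\<And>u. a u \<in> {-1, 0, 1}" and b: "\<And>u. b u \<in> {-1, 0, 1}"
    and close: "(\<Sum>u\<in>W. \<bar>a u\<bar>) - 1 \<le> (\<Sum>u\<in>W. a u * b u)"
  shows "0 \<le> a w * b w"
proof (rule ccontr)
  assume "\<not> ?thesis"
  then have "2 \<le> \<bar>a w\<bar> - a w * b w"
    using a[of w] b[of w] by auto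
  also have "\<dots> \<le> (\<Sum>u\<in>W. \<bar>a u\<bar> - a u * b u)"
  proof (rule member_le_sum[OF W(2) _ W(1)])
    show "0 \<le> \<bar>a u\<bar> - a u * b u" for u
      using a[of u] b[of u] by auto
  qed
  also have "\<dots> \<le> 1"
    using close by (simp add: sum_subtractf)
  finally show False by simp
qed

definition gram_defect :: "'b set \<Rightarrow> ('a \<Rightarrow> 'b \<Rightarrow> 'c :: comm_ring_1) \<Rightarrow> 'a \<Rightarrow> 'a \<Rightarrow> 'c" where
  "gram_defect W N x y = (\<Sum>w\<in>W. N x w * N y w) - of_bool (x = y)"

lemma gram_defect_commute: "gram_defect W N x y = gram_defect W N y x"
  by (simp add: gram_defect_def mult.commute eq_commute[of x y])

lemma gram_defect_diag:
  fixes N :: "'a \<Rightarrow> 'b \<Rightarrow> 'c :: linordered_idom"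
  assumes "\<And>x w. N x w \<in> {-1, 0, 1}"
  shows "gram_defect W N x x = (\<Sum>w\<in>W. \<bar>N x w\<bar>) - 1"
proof -
  have "N x w * N x w = \<bar>N x w\<bar>" for w
    using assms[of x w] by auto
  then show ?thesis by (simp add: gram_defect_def)
qed

lemma gram_defect_diag_nonneg:
  fixes N :: "'a \<Rightarrow> 'b \<Rightarrow> 'c :: linordered_idom"
  assumes W: "finite W" "w \<in> W" and N: "\<And>x w. N x w \<in> {-1, 0, 1}" and "N x w \<noteq> 0"
  shows "0 \<le> gram_defect W N x x"
proof -
  have "1 \<le> \<bar>N x w\<bar>"
    using N[of x w] \<open>N x w \<noteq> 0\<close> by auto
  also have "\<dots> \<le> (\<Sum>u\<in>W. \<bar>N x u\<bar>)"
    using W by (intro member_le_sum) auto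
  finally show ?thesis by (simp add: gram_defect_diag[OF N])
qed

lemma gram_defect_aligned_rows:
  fixes N :: "'a \<Rightarrow> 'b \<Rightarrow> 'c :: linordered_idom"
  assumes W: "finite W" "w \<in> W" and N: "\<And>x w. N x w \<in> {-1, 0, 1}"
    and signs: "r \<in> {-1, 1}" "s \<in> {-1, 1}" and "x \<noteq> y"
    and diag_le: "gram_defect W N x x \<le> r * s * gram_defect W N x y"
  shows "0 \<le> (r * N x w) * (s * N y w)"
proof (rule aligned_if_abs_sum_le_inner_product[
      where a = "\<lambda>w. r * N x w" and b = "\<lambda>w. s * N y w", OF W])
  show "r * N x u \<in> {-1, 0, 1}" "s * N y u \<in> {-1, 0, 1}" for u
    using signs N[of x u] N[of y u] by auto
  have "(\<Sum>u\<in>W. \<bar>r * N x u\<bar>) - 1 = gram_defect W N x x"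
    using signs by (auto simp: gram_defect_diag[OF N] abs_mult)
  also note diag_le
  also have "r * s * gram_defect W N x y = (\<Sum>u\<in>W. (r * N x u) * (s * N y u))"
    using \<open>x \<noteq> y\<close> by (simp add: gram_defect_def sum_distrib_left ac_simps)
  finally show "(\<Sum>u\<in>W. \<bar>r * N x u\<bar>) - 1 \<le> (\<Sum>u\<in>W. (r * N x u) * (s * N y u))" .
qed

lemma rank_one_gram_defect_aligned_rows:
  fixes N :: "'a \<Rightarrow> 'b \<Rightarrow> 'c :: linordered_idom"
  assumes W: "finite W" and N: "\<And>x w. N x w \<in> {-1, 0, 1}"
    and minors: "minors2_vanish_on X (gram_defect W N)"
  obtains p :: "'a \<Rightarrow> 'c" where "\<And>x. p x \<in> {-1, 1}"
    "\<And>x y w. x \<in> X \<Longrightarrow> y \<in> X \<Longrightarrow> w \<in> W \<Longrightarrow> 0 \<le> (p x * N x w) * (p y * N y w)"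
proof -
  let ?g = "gram_defect W N"
  \<comment> \<open>A zero row has the negative diagonal entry -1, but its products with other rows vanish anyway.\<close>
  define U where "U = {x \<in> X. \<exists>w\<in>W. N x w \<noteq> 0}"
  have U_minors: "minors2_vanish_on U ?g"
    by (rule minors2_vanish_on_subset[OF minors]) (auto simp: U_def)
  have nonneg: "0 \<le> ?g x x" if "x \<in> U" for x
    using that gram_defect_diag_nonneg[OF W _ N] by (auto simp: U_def)
  obtain p :: "'a \<Rightarrow> 'c" where p: "\<And>x. p x \<in> {-1, 1}"
    and p_abs: "\<And>x y. x \<in> U \<Longrightarrow> y \<in> U \<Longrightarrow> p x * p y * ?g x y = \<bar>?g x y\<bar>"
    using rank_one_psd_signs[OF U_minors gram_defect_commute nonneg] by blast
  have ordered: "0 \<le> (p x * N x w) * (p y * N y w)"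
    if xy: "x \<in> U" "y \<in> U" "w \<in> W" "x \<noteq> y" and diag_le: "?g x x \<le> ?g y y" for x y w
  proof (rule gram_defect_aligned_rows[OF W xy(3) N p p xy(4)])
    have "?g x x \<le> \<bar>?g x y\<bar>"
      using rank_one_diag_le_abs_entry[OF U_minors gram_defect_commute] xy nonneg diag_le by blast
    then show "?g x x \<le> p x * p y * ?g x y"
      using p_abs xy by simp
  qed
  have "0 \<le> (p x * N x w) * (p y * N y w)" if "x \<in> X" "y \<in> X" "w \<in> W" for x y w
  proof (cases "x \<in> U \<and> y \<in> U \<and> x \<noteq> y")
    case True
    then show ?thesis
      using ordered[of x y w] ordered[of y x w] that linear[of "?g x x" "?g y y"]
      by (auto simp: mult.commute)
  next
    case False
    then show ?thesis using that by (auto simp: U_def)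
  qed
  with p show ?thesis by (rule that)
qed

lemma aligned_rows_column_signs:
  fixes N :: "'a \<Rightarrow> 'b \<Rightarrow> 'c :: linordered_idom"
  assumes "\<And>x y w. x \<in> X \<Longrightarrow> y \<in> X \<Longrightarrow> w \<in> W \<Longrightarrow> 0 \<le> N x w * N y w"
  obtains q :: "'b \<Rightarrow> 'c" where "\<And>w. q w \<in> {-1, 1}"
    "\<And>x w. x \<in> X \<Longrightarrow> w \<in> W \<Longrightarrow> 0 \<le> N x w * q w"
proof -
  define q :: "'b \<Rightarrow> 'c" where "q w = (if \<exists>x\<in>X. N x w < 0 then -1 else 1)" for w
  have "0 \<le> N x w * q w" if x: "x \<in> X" and w: "w \<in> W" for x w
  proof (cases "\<exists>y\<in>X. N y w < 0")
    case True
    then obtain y where "y \<in> X" "N y w < 0" by blast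
    then have "N x w \<le> 0"
      using assms[OF x _ w, of y] by (auto simp: zero_le_mult_iff)
    then show ?thesis using True by (simp add: q_def)
  next
    case False
    then show ?thesis using x by (auto simp: q_def not_less)
  qed
  moreover have "q w \<in> {-1, 1}" for w by (simp add: q_def)
  ultimately show ?thesis by (rule that[rotated])
qed

section \<open>Signed graphs\<close>

definition signed_adj :: "'a pair_pre_digraph \<Rightarrow> ('a set \<Rightarrow> int) \<Rightarrow> 'a \<Rightarrow> 'a \<Rightarrow> int" where
  "signed_adj G \<sigma> u v = (if (u, v) \<in> parcs G then \<sigma> {u, v} else 0)"

lemma signed_adj_range: "signed_graph G \<sigma> \<Longrightarrow> signed_adj G \<sigma> u v \<in> {-1, 0, 1}"
  by (auto simp: signed_graph_def signed_adj_def)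

lemma signed_adj_commute:
  assumes "pair_graph G"
  shows "signed_adj G \<sigma> u v = signed_adj G \<sigma> v u"
proof -
  interpret pair_graph G by fact
  show ?thesis using arcs_symmetric by (auto simp: signed_adj_def insert_commute)
qed

lemma adjacency_matrix_carrier:
  "pair_graph G \<Longrightarrow> adjacency_matrix G \<sigma> \<in> carrier_mat (card (pverts G)) (card (pverts G))"
  by (metis (no_types, lifting) adjacency_matrix_def distinct_card mat_carrier vertex_order)

lemma vertex_order_bij_betw:
  assumes "pair_graph G"
  shows "bij_betw ((!) (vertex_order G)) {..<card (pverts G)} (pverts G)"
  using vertex_order[OF assms] distinct_card[of "vertex_order G"] by (intro bij_betw_nth) auto

lemma adjacency_matrix_index:
  assumes "pair_graph G" "i < card (pverts G)" "j < card (pverts G)"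
  shows "adjacency_matrix G \<sigma> $$ (i, j) =
    real_of_int (signed_adj G \<sigma> (vertex_order G ! i) (vertex_order G ! j))"
  using assms(2,3) vertex_order[OF assms(1)] distinct_card[of "vertex_order G"]
  by (simp add: adjacency_matrix_def Let_def signed_adj_def)

lemma char_matrix_adjacency_square_index:
  assumes G: "pair_graph G" and ij: "i < card (pverts G)" "j < card (pverts G)"
  shows "char_matrix (map_mat complex_of_real (adjacency_matrix G \<sigma>) ^\<^sub>m 2) 1 $$ (i, j) =
    of_int (gram_defect (pverts G) (signed_adj G \<sigma>) (vertex_order G ! i) (vertex_order G ! j))"
proof -
  let ?n = "card (pverts G)" and ?v = "(!) (vertex_order G)"
  let ?A = "map_mat complex_of_real (adjacency_matrix G \<sigma>)"
  have A: "?A \<in> carrier_mat ?n ?n"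
    using adjacency_matrix_carrier[OF G] by simp
  have "(?A ^\<^sub>m 2) $$ (i, j) = (\<Sum>k<?n. ?A $$ (i, k) * ?A $$ (k, j))"
    using A ij by (simp add: numeral_2_eq_2 scalar_prod_def lessThan_atLeast0)
  also have "\<dots> = (\<Sum>k<?n. of_int (signed_adj G \<sigma> (?v i) (?v k) * signed_adj G \<sigma> (?v j) (?v k)))"
    using A ij signed_adj_commute[OF G]
    by (intro sum.cong) (auto simp: adjacency_matrix_index[OF G])
  also have "\<dots> = (\<Sum>w\<in>pverts G. of_int (signed_adj G \<sigma> (?v i) w * signed_adj G \<sigma> (?v j) w))"
    by (rule sum.reindex_bij_betw[OF vertex_order_bij_betw[OF G]])
  finally have "(?A ^\<^sub>m 2) $$ (i, j) =
      of_int (\<Sum>w\<in>pverts G. signed_adj G \<sigma> (?v i) w * signed_adj G \<sigma> (?v j) w)"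
    by simp
  moreover have "?v i = ?v j \<longleftrightarrow> i = j"
    using vertex_order_bij_betw[OF G] ij by (auto simp: bij_betw_def inj_on_eq_iff)
  ultimately show ?thesis
    using A ij by (simp add: char_matrix_def gram_defect_def)
qed

lemma gram_defect_adjacency_rank:
  assumes G: "pair_graph G"
  shows "rank_at_most (size {#x \<in># eigenvalues_mset (adjacency_matrix G \<sigma>). x \<noteq> 1 \<and> x \<noteq> -1#})
    (pverts G) (pverts G)
    (\<lambda>u v. complex_of_int (gram_defect (pverts G) (signed_adj G \<sigma>) u v))"
proof -
  let ?n = "card (pverts G)" and ?v = "(!) (vertex_order G)"
  let ?A = "map_mat complex_of_real (adjacency_matrix G \<sigma>)"
  have A: "?A \<in> carrier_mat ?n ?n"
    using adjacency_matrix_carrier[OF G] by simp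
  have "mat_adjoint ?A = ?A"
    using A signed_adj_commute[OF G]
    by (intro eq_matI) (auto simp: adjacency_matrix_index[OF G])
  note rank = hermitian_rank_char_matrix_pow[OF A this, of 2 1]
  have bij: "bij_betw ?v {..<?n} (pverts G)"
    by (rule vertex_order_bij_betw[OF G])
  define pos where "pos = the_inv_into {..<?n} ?v"
  have pos: "pos u < ?n" "?v (pos u) = u" if "u \<in> pverts G" for u
    using bij that the_inv_into_into[of ?v "{..<?n}" u "{..<?n}"]
      f_the_inv_into_f_bij_betw[OF bij, of u]
    by (auto simp: pos_def bij_betw_def)
  have "rank_at_most (size {#x \<in># proots (char_poly ?A). x ^ 2 \<noteq> 1#}) (pverts G) (pverts G)
      (\<lambda>u v. char_matrix (?A ^\<^sub>m 2) 1 $$ (pos u, pos v))"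
    by (rule rank_at_most_reindex[OF rank]) (simp_all add: pos)
  moreover have "char_matrix (?A ^\<^sub>m 2) 1 $$ (pos u, pos v) =
      complex_of_int (gram_defect (pverts G) (signed_adj G \<sigma>) u v)"
    if "u \<in> pverts G" "v \<in> pverts G" for u v
    using that by (simp add: char_matrix_adjacency_square_index[OF G] pos)
  ultimately show ?thesis
    by (simp add: eigenvalues_mset_def rank_at_most_def power2_eq_1_iff)
qed

definition bipartition :: "'a pair_pre_digraph \<Rightarrow> 'a set \<Rightarrow> 'a set \<Rightarrow> bool" where
  "bipartition G X Y \<longleftrightarrow>
     pverts G = X \<union> Y \<and> X \<inter> Y = {} \<and> parcs G \<subseteq> X \<times> Y \<union> Y \<times> X"

lemma bipartition_commute: "bipartition G X Y \<longleftrightarrow> bipartition G Y X"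
  by (auto simp: bipartition_def)

lemma gram_defect_adjacency_off_block:
  assumes "bipartition G X Y" "x \<in> X" "y \<in> Y"
  shows "gram_defect (pverts G) (signed_adj G \<sigma>) x y = 0"
proof -
  have "(x, w) \<notin> parcs G \<or> (y, w) \<notin> parcs G" for w
    using assms unfolding bipartition_def by blast
  then have "signed_adj G \<sigma> x w * signed_adj G \<sigma> y w = 0" for w
    by (auto simp: signed_adj_def)
  moreover have "x \<noteq> y" using assms by (auto simp: bipartition_def)
  ultimately show ?thesis by (simp add: gram_defect_def)
qed

definition balanced :: "'a pair_pre_digraph \<Rightarrow> ('a set \<Rightarrow> int) \<Rightarrow> bool" where
  "balanced G \<sigma> \<longleftrightarrow>
     (\<exists>t. (\<forall>v. t v \<in> {-1, 1}) \<and> (\<forall>u v. (u, v) \<in> parcs G \<longrightarrow> \<sigma> {u, v} = t u * t v))"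

lemma bipartite_rank_one_balanced:
  assumes sg: "signed_graph G \<sigma>" and XY: "bipartition G X Y"
    and minors: "minors2_vanish_on X (gram_defect (pverts G) (signed_adj G \<sigma>))"
  shows "balanced G \<sigma>"
proof -
  have G: "pair_graph G" using sg by (simp add: signed_graph_def)
  interpret pair_graph G by fact
  obtain p where p: "\<And>x. p x \<in> {-1, 1 :: int}"
    and rows: "\<And>x y w. x \<in> X \<Longrightarrow> y \<in> X \<Longrightarrow> w \<in> pverts G \<Longrightarrow>
      0 \<le> (p x * signed_adj G \<sigma> x w) * (p y * signed_adj G \<sigma> y w)"
    using rank_one_gram_defect_aligned_rows[OF pair_finite_verts signed_adj_range[OF sg] minors]
    by blast
  obtain q where q: "\<And>w. q w \<in> {-1, 1 :: int}"
    and pq: "\<And>x w. x \<in> X \<Longrightarrow> w \<in> pverts G \<Longrightarrow> 0 \<le> (p x * signed_adj G \<sigma> x w) * q w"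
    using aligned_rows_column_signs[where N = "\<lambda>x w. p x * signed_adj G \<sigma> x w", OF rows] by blast
  define t where "t v = (if v \<in> X then p v else q v)" for v
  have from_X: "\<sigma> {u, v} = t u * t v" if "(u, v) \<in> parcs G" "u \<in> X" for u v
  proof -
    have "v \<notin> X" "v \<in> pverts G" using that XY by (auto simp: bipartition_def)
    moreover have "\<sigma> {u, v} \<in> {-1, 1}" using sg that by (auto simp: signed_graph_def)
    ultimately show ?thesis
      using pq[OF that(2), of v] p[of u] q[of v] that by (auto simp: t_def signed_adj_def)
  qed
  have "\<sigma> {u, v} = t u * t v" if "(u, v) \<in> parcs G" for u v
  proof (cases "u \<in> X")
    case True
    then show ?thesis using from_X that by simp
  next
    case False
    then have "v \<in> X" using that XY by (auto simp: bipartition_def)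
    then show ?thesis
      using from_X[OF arcs_symmetric[OF that]] by (simp add: insert_commute mult.commute)
  qed
  moreover have "t v \<in> {-1, 1}" for v using p q by (simp add: t_def)
  ultimately show ?thesis unfolding balanced_def by blast
qed

theorem bipartite_two_exceptional_eigenvalues_balanced:
  assumes sg: "signed_graph G \<sigma>" and bip: "bipartite_graph G"
    and ev: "size {#x \<in># eigenvalues_mset (adjacency_matrix G \<sigma>). x \<noteq> 1 \<and> x \<noteq> -1#} \<le> 2"
  shows "balanced G \<sigma>"
proof -
  have G: "pair_graph G" using sg by (simp add: signed_graph_def)
  let ?M = "gram_defect (pverts G) (signed_adj G \<sigma>)"
  obtain X Y where XY: "bipartition G X Y"
    using bip by (auto simp: bipartite_graph_def bipartition_def)
  have "rank_at_most 2 (X \<union> Y) (X \<union> Y) (\<lambda>u v. complex_of_int (?M u v))"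
    using rank_at_most_mono[OF gram_defect_adjacency_rank[OF G] ev] XY by (simp add: bipartition_def)
  then have "minors2_vanish_on X (\<lambda>u v. complex_of_int (?M u v)) \<or>
      (\<forall>y\<in>Y. \<forall>z\<in>Y. complex_of_int (?M y z) = 0)"
    by (rule diag_block_rank_2_minors2_vanish) (simp add: gram_defect_adjacency_off_block[OF XY])
  then have "minors2_vanish_on X ?M \<or> minors2_vanish_on Y ?M"
    by (auto simp: minors2_vanish_on_def simp flip: of_int_mult)
  then show ?thesis
    using bipartite_rank_one_balanced[OF sg] XY bipartition_commute by blast
qed

lemma balanced_switching_isomorphic_all_positive:
  assumes G: "pair_graph G" and bal: "balanced G \<sigma>"
  shows "switching_isomorphic G \<sigma> G all_positive"
proof -
  interpret pair_graph G by fact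
  obtain t where t: "\<And>v. t v \<in> {-1, 1}" and \<sigma>: "\<And>u v. (u, v) \<in> parcs G \<Longrightarrow> \<sigma> {u, v} = t u * t v"
    using bal unfolding balanced_def by blast
  let ?X = "{v \<in> pverts G. t v = -1}"
  have "switch ?X \<sigma> {u, v} = 1" if "(u, v) \<in> parcs G" for u v
    using t[of u] t[of v] \<sigma>[OF that] in_arcsD1[OF that] in_arcsD2[OF that]
    by (auto simp: switch_def)
  then have "signed_graph_iso G (switch ?X \<sigma>) G all_positive"
    unfolding signed_graph_iso_def by (intro exI[of _ id]) (auto simp: all_positive_def)
  then show ?thesis
    unfolding switching_isomorphic_def by (intro exI[of _ ?X]) simp
qed

lemma eigenvalues_mset_sign_conjugate:
  assumes A: "A \<in> carrier_mat n n" and t: "\<And>i. i < n \<Longrightarrow> t i * t i = 1"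
  shows "eigenvalues_mset (mat n n (\<lambda>(i, j). t i * A $$ (i, j) * t j)) = eigenvalues_mset A"
proof -
  let ?A = "map_mat complex_of_real A" and ?D = "mat_diag n (\<lambda>i. complex_of_real (t i))"
  let ?B = "map_mat complex_of_real (mat n n (\<lambda>(i, j). t i * A $$ (i, j) * t j))"
  have cA: "?A \<in> carrier_mat n n" using A by simp
  have DD: "?D * ?D = 1\<^sub>m n"
    unfolding mat_diag_diag by (rule eq_matI) (auto simp: mat_diag_def t simp flip: of_real_mult)
  have B: "?B = ?D * ?A * ?D"
    unfolding mat_diag_mult_left[OF cA] using A
    by (subst mat_diag_mult_right[of _ n n]) (auto intro!: eq_matI)
  have "similar_mat_wit ?B ?A ?D ?D"
    by (rule similar_mat_witI[OF DD DD B _ cA]) simp_all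
  then have "char_poly ?B = char_poly ?A"
    by (intro char_poly_similar) (auto simp: similar_mat_def)
  then show ?thesis by (simp add: eigenvalues_mset_def)
qed

lemma balanced_eigenvalues_mset_all_positive:
  assumes G: "pair_graph G" and bal: "balanced G \<sigma>"
  shows "eigenvalues_mset (adjacency_matrix G all_positive) =
    eigenvalues_mset (adjacency_matrix G \<sigma>)"
proof -
  let ?n = "card (pverts G)"
  obtain t where t: "\<And>v. t v \<in> {-1, 1}" and \<sigma>: "\<And>u v. (u, v) \<in> parcs G \<Longrightarrow> \<sigma> {u, v} = t u * t v"
    using bal unfolding balanced_def by blast
  define s where "s i = real_of_int (t (vertex_order G ! i))" for i
  have s: "s i * s i = 1" for i
    using t[of "vertex_order G ! i"] by (auto simp: s_def)
  have "signed_adj G all_positive u v = t u * signed_adj G \<sigma> u v * t v" for u v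
    using t[of u] t[of v] \<sigma>[of u v] by (auto simp: signed_adj_def all_positive_def)
  then have "adjacency_matrix G all_positive =
      mat ?n ?n (\<lambda>(i, j). s i * adjacency_matrix G \<sigma> $$ (i, j) * s j)"
    using adjacency_matrix_carrier[OF G, of all_positive]
    by (intro eq_matI) (auto simp: adjacency_matrix_index[OF G] s_def)
  then show ?thesis
    using eigenvalues_mset_sign_conjugate[OF adjacency_matrix_carrier[OF G] s] by simp
qed

theorem theorem4p1:
  fixes G :: "'a pair_pre_digraph" and \<sigma> :: "'a set \<Rightarrow> int"
  assumes "signed_graph G \<sigma>"
    and "connected_graph G"
    and "bipartite_graph G"
    and "size {#x \<in># eigenvalues_mset (adjacency_matrix G \<sigma>). x \<noteq> 1 \<and> x \<noteq> -1#} \<le> 2"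
  shows "\<exists>H :: 'a pair_pre_digraph.
           pair_graph H \<and> connected_graph H \<and> bipartite_graph H \<and>
           size {#x \<in># eigenvalues_mset (adjacency_matrix H all_positive). x \<noteq> 1 \<and> x \<noteq> -1#} \<le> 2 \<and>
           switching_isomorphic G \<sigma> H all_positive"
proof (intro exI[of _ G] conjI)
  show G: "pair_graph G"
    using assms(1) by (simp add: signed_graph_def)
  have bal: "balanced G \<sigma>"
    by (rule bipartite_two_exceptional_eigenvalues_balanced[OF assms(1,3,4)])
  show "switching_isomorphic G \<sigma> G all_positive"
    by (rule balanced_switching_isomorphic_all_positive[OF G bal])
  show "size {#x \<in># eigenvalues_mset (adjacency_matrix G all_positive). x \<noteq> 1 \<and> x \<noteq> -1#} \<le> 2"
    using assms(4) by (simp only: balanced_eigenvalues_mset_all_positive[OF G bal])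
qed (use assms in simp_all)

end
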